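(* Let $\mu=(\mu_0,\ldots,\mu_{T-1})\in\mathbb{R}_+^{T}$ and let $n=(n^a)_{a\in A}$ be an initial state with $n^a\in\mathbb{N}^2$ for each $a\in A$. Let $\psi=\mathrm{DeCo}[\mu]$ be the DeCo policy associated with $\mu$, let $N^\psi_t=(N^{\psi,a}_t)_{a\in A}$ be the state process it generates from $N_0^\psi=n$, and write $a^\star_t=a^\star_t(N^\psi_t)$ for the arm it selects at time $t$. Then $$V^r_0[\mu](n)-V^{\psi}_0(n)=\sum_{t=0}^{T-1}\mathbb{E}_n\Big[\big(\mu_t-I^{a^\star_t}_t[\mu](N^{\psi,a^\star_t}_t)\big)^+ +\sum_{a\in A(t,\mu,N^\psi_t)}\big(I^a_t[\mu](N^{\psi,a}_t)-\mu_t\big)\Big],$$ where, for any state $m=(m^a)_{a\in A}$, $A(t,\mu,m)=\{a\in A:\ a\neq a^\star_t(m)\ \text{and}\ I^a_t[\mu](m^a)\ge\mu_t\}$.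
   Context: **Bandit model.** $T\ge 1$ is an integer (horizon), $A$ is a finite nonempty set (arms), $\mathbb{N}=\{1,2,\dots\}$, $x^+=\max(x,0)$. For each arm $a\in A$ and $t\in\{0,\dots,T-1\}$ a reward function $L^a_t:\{\mathtt{B},\mathtt{G}\}\to\mathbb{R}$ is given. A state is $n=(n^a)_{a\in A}$ with $n^a=(n^{\mathtt{B}a},n^{\mathtt{G}a})\in\mathbb{N}^2$. **Probability $\mathbb{E}_n$.** Given $n$, the unknown parameters $p^a=(p^{\mathtt{B}a},p^{\mathtt{G}a})$ (with $p^{\mathtt{B}a}+p^{\mathtt{G}a}=1$), $a\in A$, are independent, $p^{\mathtt{B}a}$ having the Beta distribution $\beta(n^{\mathtt{B}a},n^{\mathtt{G}a})$; conditionally on $(p^a)_{a\in A}$ the outcomes $W^a_t\in\{\mathtt{B},\mathtt{G}\}$, $a\in A$, $t\in\{1,\dots,T\}$, are independent with $W^a_t=\mathtt{G}$ with probability $p^{\mathtt{G}a}$ and $W^a_t=\mathtt{B}$ with probability $p^{\mathtt{B}a}$. $\mathbb{E}_n$ is the corresponding expectation. **Functions.** For $(b,g)\in\mathbb{N}^2$, $\ell^a_t(b,g)=\frac{b}{b+g}L^a_t(\mathtt{B})+\frac{g}{b+g}L^a_t(\mathtt{G})$, and for a function $\varphi$ on $\mathbb{N}^2$, $\overline{\overline{\varphi}}(b,g)=\frac{b}{b+g}\varphi(b+1,g)+\frac{g}{b+g}\varphi(b,g+1)$. For $\mu\in\mathbb{R}^T$, the single-arm value functions $V^a_t[\mu]:\mathbb{N}^2\to\mathbb{R}$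 are defined by $V^a_T[\mu]=0$ and, for $t=T-1,\dots,0$, $$V^a_t[\mu](b,g)=\max\big\{V^a_{t+1}[\mu](b,g),\ -\mu_t+\ell^a_t(b,g)+\overline{\overline{V^a_{t+1}[\mu]}}(b,g)\big\}.$$ The value of the relaxed problem is $V^r_0[\mu](n)=\sum_{a\in A}V^a_0[\mu](n^a)+\sum_{t=0}^{T-1}\mu_t$. The index is $I^a_t[\mu](b,g)=\overline{\overline{V^a_{t+1}[\mu]}}(b,g)-V^a_{t+1}[\mu](b,g)+\ell^a_t(b,g)$. **DeCo policy.** For each $t\in\{0,\dots,T-1\}$ and each state $m=(m^a)_{a\in A}$, a single arm $a^\star_t(m)\in\arg\max_{a\in A}I^a_t[\mu](m^a)$ is selected (ties broken by an arbitrary fixed rule). The policy $\psi=\mathrm{DeCo}[\mu]$ is $\psi^a_t(m)=1$ if $a=a^\star_t(m)$ and $\psi_t^a(m)=0$ otherwise. Its state process is $N^{\psi,a}_t=(N^{\psi,a,\mathtt{B}}_t,N^{\psi,a,\mathtt{G}}_t)$ with $N_0^{\psi,a}=n^a$ and $N^{\psi,a,g}_{t+1}=N^{\psi,a,g}_t+\psi^a_t(N^\psi_t)\mathbf{1}_{\{W^a_{t+1}=g\}}$, $g\in\{\mathtt{B},\mathtt{G}\}$. Its total expected reward is $V^\psi_0(n)=\mathbb{E}_n\big[\sum_{t=0}^{T-1}\sum_{a\in A}\ell^a_t(N^{\psi,a}_t)\,\psi^a_t(N^\psi_t)\big]$. *)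

theory Defs
  imports "HOL-Probability.Probability"
begin

datatype outcome = Bad | Good

text \<open>A single-arm state \<open>(b, g)\<close> is a pair of positive counts, \<open>b\<close> for \<open>Bad\<close> and
  \<open>g\<close> for \<open>Good\<close>. Families indexed by the arms \<open>A\<close> are extensional functions.\<close>

definition states :: "'a set \<Rightarrow> ('a \<Rightarrow> nat \<times> nat) set" where
  "states A = (\<Pi>\<^sub>E a\<in>A. {1..} \<times> {1..})"


subsection \<open>Probability\<close>

definition beta_density :: "real \<Rightarrow> real \<Rightarrow> real \<Rightarrow> real" where
  "beta_density \<alpha> \<beta> x =
     (if 0 < x \<and> x < 1 then x powr (\<alpha> - 1) * (1 - x) powr (\<beta> - 1) / Beta \<alpha> \<beta> else 0)"

text \<open>
  \<open>p a\<close> is the random parameter of arm \<open>a\<close> and \<open>W a t\<close> its outcome at time \<open>t\<close>.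
  Since \<open>p a Good = 1 - p a Bad\<close>, independence of the vectors \<open>p a\<close> is that of the \<open>p a Bad\<close>,
  and both generate the same \<open>\<sigma>\<close>-algebra \<open>param_algebra\<close>.
  The assumption \<open>outcomes\<close> says that, conditionally on the parameters, the \<open>W a t\<close> are
  independent and \<open>W a t = x\<close> has probability \<open>p a x\<close>: it gives the conditional probability of
  every joint realisation \<open>w\<close> of the outcomes.
\<close>

definition param_algebra ::
  "'w measure \<Rightarrow> 'a set \<Rightarrow> ('a \<Rightarrow> outcome \<Rightarrow> 'w \<Rightarrow> real) \<Rightarrow> 'w measure" where
  "param_algebra M A p =
     vimage_algebra (space M) (\<lambda>\<omega>. \<lambda>a\<in>A. p a Bad \<omega>) (\<Pi>\<^sub>M a\<in>A. borel)"

locale bandit_model = prob_space M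
  for M :: "'w measure" +
  fixes A :: "'a set" and T :: nat and n :: "'a \<Rightarrow> nat \<times> nat"
    and p :: "'a \<Rightarrow> outcome \<Rightarrow> 'w \<Rightarrow> real"
    and W :: "'a \<Rightarrow> nat \<Rightarrow> 'w \<Rightarrow> outcome"
  assumes params_sum: "\<And>a \<omega>. a \<in> A \<Longrightarrow> \<omega> \<in> space M \<Longrightarrow> p a Bad \<omega> + p a Good \<omega> = 1"
    and params_indep: "indep_vars (\<lambda>_. borel) (\<lambda>a. p a Bad) A"
    and params_beta: "\<And>a. a \<in> A \<Longrightarrow>
      distributed M lborel (p a Bad) (\<lambda>x. ennreal (beta_density (fst (n a)) (snd (n a)) x))"
    and outcomes_measurable: "\<And>a t. a \<in> A \<Longrightarrow> t \<in> {1..T} \<Longrightarrow> W a t \<in> M \<rightarrow>\<^sub>M count_space UNIV"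
    and outcomes: "\<And>w. AE \<omega> in M.
      real_cond_exp M (param_algebra M A p)
        (indicator {\<omega> \<in> space M. \<forall>a\<in>A. \<forall>t\<in>{1..T}. W a t \<omega> = w a t}) \<omega>
      = (\<Prod>a\<in>A. \<Prod>t=1..T. p a (w a t) \<omega>)"


subsection \<open>Value functions and index\<close>

definition mean_reward ::
  "('a \<Rightarrow> nat \<Rightarrow> outcome \<Rightarrow> real) \<Rightarrow> 'a \<Rightarrow> nat \<Rightarrow> nat \<times> nat \<Rightarrow> real" where
  "mean_reward L a t = (\<lambda>(b, g). real b / real (b + g) * L a t Bad + real g / real (b + g) * L a t Good)"

definition predict :: "(nat \<times> nat \<Rightarrow> real) \<Rightarrow> nat \<times> nat \<Rightarrow> real" where
  "predict \<phi> = (\<lambda>(b, g). real b / real (b + g) * \<phi> (b + 1, g) + real g / real (b + g) * \<phi> (b, g + 1))"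

text \<open>A vector \<open>\<mu> \<in> \<real>\<^sup>T\<close> is a function on \<open>nat\<close> of which only the values at \<open>t < T\<close> are used.\<close>

function arm_value ::
  "('a \<Rightarrow> nat \<Rightarrow> outcome \<Rightarrow> real) \<Rightarrow> nat \<Rightarrow> (nat \<Rightarrow> real) \<Rightarrow> 'a \<Rightarrow> nat \<Rightarrow> nat \<times> nat \<Rightarrow> real" where
  "arm_value L T \<mu> a t =
     (if t < T
      then (\<lambda>s. max (arm_value L T \<mu> a (t + 1) s)
                    (- \<mu> t + mean_reward L a t s + predict (arm_value L T \<mu> a (t + 1)) s))
      else (\<lambda>s. 0))"
  by pat_completeness auto
termination
  by (relation "Wellfounded.measure (\<lambda>(L, T, \<mu>, a, t). T - t)") auto

declare arm_value.simps [simp del]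

definition relaxed_value ::
  "('a \<Rightarrow> nat \<Rightarrow> outcome \<Rightarrow> real) \<Rightarrow> 'a set \<Rightarrow> nat \<Rightarrow> (nat \<Rightarrow> real) \<Rightarrow> ('a \<Rightarrow> nat \<times> nat) \<Rightarrow> real" where
  "relaxed_value L A T \<mu> n = (\<Sum>a\<in>A. arm_value L T \<mu> a 0 (n a)) + (\<Sum>t<T. \<mu> t)"

definition arm_index ::
  "('a \<Rightarrow> nat \<Rightarrow> outcome \<Rightarrow> real) \<Rightarrow> nat \<Rightarrow> (nat \<Rightarrow> real) \<Rightarrow> 'a \<Rightarrow> nat \<Rightarrow> nat \<times> nat \<Rightarrow> real" where
  "arm_index L T \<mu> a t s =
     predict (arm_value L T \<mu> a (t + 1)) s - arm_value L T \<mu> a (t + 1) s + mean_reward L a t s"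


subsection \<open>Policies\<close>

text \<open>A selection \<open>sel t m\<close> picks the arm to play at time \<open>t\<close> in state \<open>m\<close>; every such
  function of \<open>(t, m)\<close> that maximises the index amounts to a fixed tie-breaking rule.\<close>

definition deco_selection ::
  "('a \<Rightarrow> nat \<Rightarrow> outcome \<Rightarrow> real) \<Rightarrow> 'a set \<Rightarrow> nat \<Rightarrow> (nat \<Rightarrow> real)
   \<Rightarrow> (nat \<Rightarrow> ('a \<Rightarrow> nat \<times> nat) \<Rightarrow> 'a) \<Rightarrow> bool" where
  "deco_selection L A T \<mu> sel \<longleftrightarrow>
     (\<forall>t<T. \<forall>m\<in>states A. is_arg_max (\<lambda>a. arm_index L T \<mu> a t (m a)) (\<lambda>a. a \<in> A) (sel t m))"

definition deco_policy ::
  "(nat \<Rightarrow> ('a \<Rightarrow> nat \<times> nat) \<Rightarrow> 'a) \<Rightarrow> nat \<Rightarrow> ('a \<Rightarrow> nat \<times> nat) \<Rightarrow> 'a \<Rightarrow> nat" where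
  "deco_policy sel t m a = (if a = sel t m then 1 else 0)"

primrec state_process ::
  "(nat \<Rightarrow> ('a \<Rightarrow> nat \<times> nat) \<Rightarrow> 'a \<Rightarrow> nat) \<Rightarrow> ('a \<Rightarrow> nat \<Rightarrow> 'w \<Rightarrow> outcome) \<Rightarrow> ('a \<Rightarrow> nat \<times> nat)
   \<Rightarrow> nat \<Rightarrow> 'w \<Rightarrow> 'a \<Rightarrow> nat \<times> nat" where
  "state_process \<psi> W n 0 \<omega> = n"
| "state_process \<psi> W n (Suc t) \<omega> =
     (let m = state_process \<psi> W n t \<omega>
      in (\<lambda>a. (fst (m a) + \<psi> t m a * of_bool (W a (Suc t) \<omega> = Bad),
               snd (m a) + \<psi> t m a * of_bool (W a (Suc t) \<omega> = Good))))"

definition policy_value ::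
  "'w measure \<Rightarrow> ('a \<Rightarrow> nat \<Rightarrow> 'w \<Rightarrow> outcome) \<Rightarrow> ('a \<Rightarrow> nat \<Rightarrow> outcome \<Rightarrow> real) \<Rightarrow> 'a set \<Rightarrow> nat
   \<Rightarrow> (nat \<Rightarrow> ('a \<Rightarrow> nat \<times> nat) \<Rightarrow> 'a \<Rightarrow> nat) \<Rightarrow> ('a \<Rightarrow> nat \<times> nat) \<Rightarrow> real" where
  "policy_value M W L A T \<psi> n =
     (\<integral>\<omega>. (\<Sum>t<T. \<Sum>a\<in>A. mean_reward L a t (state_process \<psi> W n t \<omega> a)
                           * real (\<psi> t (state_process \<psi> W n t \<omega>) a)) \<partial>M)"

definition above_arms ::
  "('a \<Rightarrow> nat \<Rightarrow> outcome \<Rightarrow> real) \<Rightarrow> 'a set \<Rightarrow> nat \<Rightarrow> (nat \<Rightarrow> real)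
   \<Rightarrow> (nat \<Rightarrow> ('a \<Rightarrow> nat \<times> nat) \<Rightarrow> 'a) \<Rightarrow> nat \<Rightarrow> ('a \<Rightarrow> nat \<times> nat) \<Rightarrow> 'a set" where
  "above_arms L A T \<mu> sel t m = {a \<in> A. a \<noteq> sel t m \<and> arm_index L T \<mu> a t (m a) \<ge> \<mu> t}"

end

theory Submission
  imports Defs
begin

text \<open>
  Write \<open>V\<^sub>t\<^sup>a\<close>, \<open>I\<^sub>t\<^sup>a\<close> and \<open>\<ell>\<^sub>t\<^sup>a\<close> for \<^const>\<open>arm_value\<close>, \<^const>\<open>arm_index\<close> and
  \<^const>\<open>mean_reward\<close>. The identity is a telescoping sum of the potential
  \<open>\<Phi>\<^sub>t(m) = \<Sum>a\<in>A. V\<^sub>t\<^sup>a(m\<^sup>a)\<close> along the state process.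

  The Bellman recursion reads \<open>V\<^sub>t\<^sup>a = V\<^sub>t\<^sub>+\<^sub>1\<^sup>a + (I\<^sub>t\<^sup>a - \<mu>\<^sub>t)\<^sup>+\<close>. When arm \<open>a*\<close> is played in state \<open>m\<close>
  only its component changes, and the expectation of \<open>V\<^sub>t\<^sub>+\<^sub>1\<^sup>a\<^sup>*\<close> after the move, under the posterior
  mean of the parameter of \<open>a*\<close>, is \<open>V\<^sub>t\<^sub>+\<^sub>1\<^sup>a\<^sup>* + I\<^sub>t\<^sup>a\<^sup>* - \<ell>\<^sub>t\<^sup>a\<^sup>*\<close> by definition of the index. So the expected
  one-step drop of \<open>\<Phi>\<close>, plus \<open>\<mu>\<^sub>t\<close>, minus the reward earned, equals
  \<open>\<mu>\<^sub>t - I\<^sub>t\<^sup>a\<^sup>* + \<Sum>a\<in>A. (I\<^sub>t\<^sup>a - \<mu>\<^sub>t)\<^sup>+\<close>, which is the summand on the right-hand side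
  (\<open>potential_drop\<close>). Summing over \<open>t\<close> gives the claim, as \<open>\<Phi>\<^sub>0(n)\<close> is the relaxed value less
  \<open>\<Sum>t<T. \<mu>\<^sub>t\<close>, and \<open>\<Phi>\<^sub>T = 0\<close>.

  The probabilistic input is that, given the current state, the next outcome of the arm played is
  distributed according to the posterior mean (\<open>next_outcome_given_state\<close>). It is obtained by
  computing, for every monomial \<open>p\<^sup>e\<close> in the parameters, the expectation of \<open>p\<^sup>e\<close> on the event
  \<open>{N\<^sub>t = m}\<close>. This is a constant depending on \<open>t\<close> and \<open>m\<close> only (up to the normalisation of the prior, the number of
  observation histories leading to \<open>m\<close>) times a product of Beta functions at \<open>m + e\<close>
  (\<open>state_monomial_moment\<close>). The constant cancels in a quotient of two such expectations, and
  \<open>B(b + 1, g) / B(b, g) = b / (b + g)\<close>.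
\<close>

section \<open>Moments of the Beta distribution\<close>

lemma Beta_plus1_left_fraction:
  fixes x y :: real
  assumes "x > 0" "y > 0"
  shows "Beta (x + 1) y = x / (x + y) * Beta x y"
proof -
  have "x \<notin> \<int>\<^sub>\<le>\<^sub>0"
    using assms by (auto elim!: nonpos_Ints_cases')
  then show ?thesis
    using Beta_plus1_left[of x y] assms by (simp add: field_simps)
qed

lemma Beta_plus1_right_fraction:
  fixes x y :: real
  assumes "x > 0" "y > 0"
  shows "Beta x (y + 1) = y / (x + y) * Beta x y"
  using Beta_plus1_left_fraction[OF assms(2,1)] by (simp add: Beta_commute add.commute)

lemma beta_density_nonneg: "\<alpha> > 0 \<Longrightarrow> \<beta> > 0 \<Longrightarrow> beta_density \<alpha> \<beta> x \<ge> 0"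
  by (simp add: beta_density_def Beta_def less_imp_le)

lemma beta_density_moment:
  fixes \<alpha> \<beta> :: real and i j :: nat
  assumes "\<alpha> > 0" "\<beta> > 0"
  shows "integrable lborel (\<lambda>x. beta_density \<alpha> \<beta> x * (x ^ i * (1 - x) ^ j))" (is ?int)
    and "(\<integral>x. beta_density \<alpha> \<beta> x * (x ^ i * (1 - x) ^ j) \<partial>lborel)
      = Beta (\<alpha> + real i) (\<beta> + real j) / Beta \<alpha> \<beta>" (is ?eq)
proof -
  let ?f = "\<lambda>x. x powr (\<alpha> + real i - 1) * (1 - x) powr (\<beta> + real j - 1)"
  have eq: "beta_density \<alpha> \<beta> x * (x ^ i * (1 - x) ^ j) = (indicator {0..1} x *\<^sub>R ?f x) / Beta \<alpha> \<beta>" for x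
  proof (cases "0 < x \<and> x < 1")
    case True
    then show ?thesis
      by (simp add: beta_density_def powr_realpow[symmetric] powr_add[symmetric] field_simps)
  next
    case False
    \<comment> \<open>at the endpoints the right-hand side vanishes because \<open>0 powr c = 0\<close> for every \<open>c\<close>\<close>
    then have "x \<notin> {0..1} \<or> x = 0 \<or> x = 1" by auto
    with False show ?thesis by (auto simp: beta_density_def)
  qed
  have int: "set_integrable lborel {0..1} ?f"
    using assms by (intro integrable_Beta) auto
  have "(LINT x:{0..1}|lborel. ?f x) = Beta (\<alpha> + real i) (\<beta> + real j)"
    using set_borel_integral_eq_integral(2)[OF int] assms has_integral_Beta_real[of "\<alpha> + real i" "\<beta> + real j"]
    by (simp add: integral_unique)
  with int show ?int ?eq
    unfolding eq set_integrable_def set_lebesgue_integral_def by auto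
qed

section \<open>Sums over tables of outcomes\<close>

lemma outcome_UNIV: "(UNIV :: outcome set) = {Bad, Good}"
  using outcome.exhaust by auto

lemma finite_outcomes [simp]: "finite (UNIV :: outcome set)"
  by (simp add: outcome_UNIV)

lemma sum_outcome_match:
  "(\<Sum>x\<in>UNIV. h x * of_bool (P \<and> y = x)) = (if P then h (y :: outcome) else (0 :: real))"
  by (cases y) (simp_all add: outcome_UNIV)

lemma sum_PiE_split:
  assumes "finite J" "i \<in> J"
  shows "(\<Sum>w\<in>J \<rightarrow>\<^sub>E (UNIV :: outcome set). h w :: real)
    = (\<Sum>v\<in>(J - {i}) \<rightarrow>\<^sub>E UNIV. \<Sum>y\<in>UNIV. h (v(i := y)))"
proof -
  have "J \<rightarrow>\<^sub>E UNIV = (\<lambda>(y, v). v(i := y)) ` (UNIV \<times> ((J - {i}) \<rightarrow>\<^sub>E (UNIV :: outcome set)))"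
    using PiE_insert_eq[of i "J - {i}" "\<lambda>_. UNIV :: outcome set"] assms by (simp add: insert_absorb)
  then have "(\<Sum>w\<in>J \<rightarrow>\<^sub>E (UNIV :: outcome set). h w)
    = (\<Sum>(y, v)\<in>UNIV \<times> ((J - {i}) \<rightarrow>\<^sub>E UNIV). h (v(i := y)))"
    using inj_combinator[of i "J - {i}" "\<lambda>_. UNIV :: outcome set"]
    by (simp add: sum.reindex case_prod_unfold)
  then show ?thesis
    by (simp add: sum.cartesian_product[symmetric] sum.swap[of _ UNIV])
qed

text \<open>Under a product of probability weights, fixing one coordinate amounts to multiplying by its
  weight, when tested against functions that do not depend on that coordinate.\<close>

lemma product_weight_condition:
  fixes q :: "'i \<Rightarrow> outcome \<Rightarrow> real" and g :: "('i \<Rightarrow> outcome) \<Rightarrow> real"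
  assumes "finite J" "i \<in> J"
    and q: "q i Bad + q i Good = 1"
    and g: "\<And>w y. g (w(i := y)) = g w"
  shows "(\<Sum>w\<in>J \<rightarrow>\<^sub>E UNIV. g w * of_bool (w i = x) * (\<Prod>j\<in>J. q j (w j)))
    = q i x * (\<Sum>w\<in>J \<rightarrow>\<^sub>E UNIV. g w * (\<Prod>j\<in>J. q j (w j)))"
proof -
  have split: "(\<Prod>j\<in>J. q j ((v(i := y)) j)) = q i y * (\<Prod>j\<in>J - {i}. q j (v j))" for v y
    using assms(1,2) by (simp add: prod.remove[of J i])
  have q': "q i Good = 1 - q i Bad" using q by simp
  show ?thesis
    unfolding sum_PiE_split[OF assms(1,2)] split sum_distrib_left g
    by (rule sum.cong; cases x) (simp_all add: outcome_UNIV q' algebra_simps)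
qed

section \<open>Dynamics of the state process\<close>

text \<open>The state reached from \<open>m\<close> when arm \<open>a\<close> is played with outcome \<open>x\<close>.\<close>

definition observe :: "('a \<Rightarrow> nat \<times> nat) \<Rightarrow> 'a \<Rightarrow> outcome \<Rightarrow> 'a \<Rightarrow> nat \<times> nat" where
  "observe m a x = m(a := (fst (m a) + of_bool (x = Bad), snd (m a) + of_bool (x = Good)))"

text \<open>The mean of the parameter for outcome \<open>x\<close> under the Beta distribution with counts \<open>s\<close>.\<close>

definition posterior_mean :: "nat \<times> nat \<Rightarrow> outcome \<Rightarrow> real" where
  "posterior_mean s x = real (case x of Bad \<Rightarrow> fst s | Good \<Rightarrow> snd s) / real (fst s + snd s)"

lemma posterior_mean_sum: "s \<in> {1..} \<times> {1..} \<Longrightarrow> posterior_mean s Bad + posterior_mean s Good = 1"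
  by (auto simp: posterior_mean_def add_divide_distrib[symmetric])

lemma predict_eq:
  "predict \<phi> s = posterior_mean s Bad * \<phi> (fst s + 1, snd s)
    + posterior_mean s Good * \<phi> (fst s, snd s + 1)"
  by (cases s) (simp add: predict_def posterior_mean_def)

lemma observe_in_states: "m \<in> states A \<Longrightarrow> a \<in> A \<Longrightarrow> observe m a x \<in> states A"
  by (auto simp: states_def observe_def PiE_iff extensional_def)

lemma state_process_Suc:
  "state_process (deco_policy sel) W n (Suc t) \<omega> =
    (let m = state_process (deco_policy sel) W n t \<omega> in observe m (sel t m) (W (sel t m) (Suc t) \<omega>))"
  by (auto simp: Let_def deco_policy_def observe_def fun_eq_iff)

lemma state_process_in_states:
  assumes "n \<in> states A" "\<And>t m. t < T \<Longrightarrow> m \<in> states A \<Longrightarrow> sel t m \<in> A" "t \<le> T"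
  shows "state_process (deco_policy sel) W n t \<omega> \<in> states A"
  using assms(3)
  by (induction t) (auto simp: assms Let_def state_process_Suc intro!: observe_in_states simp del: state_process.simps(2))

text \<open>Up to time \<open>t\<close> the process only depends on the outcomes of the arms in \<open>A\<close> at times \<open>1..t\<close>. The
  two families of outcomes may live on different sample spaces.\<close>

lemma state_process_cong:
  assumes "n \<in> states A" "\<And>t m. t < T \<Longrightarrow> m \<in> states A \<Longrightarrow> sel t m \<in> A" "t \<le> T"
    and "\<And>a s. a \<in> A \<Longrightarrow> s \<in> {1..t} \<Longrightarrow> W a s \<omega> = W' a s \<omega>'"
  shows "state_process (deco_policy sel) W n t \<omega> = state_process (deco_policy sel) W' n t \<omega>'"
  using assms(3,4)
proof (induction t)
  case (Suc t)
  let ?m = "state_process (deco_policy sel) W n t \<omega>"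
  have "?m = state_process (deco_policy sel) W' n t \<omega>'"
    using Suc by auto
  moreover have "sel t ?m \<in> A"
    using Suc.prems by (intro assms(2) state_process_in_states[OF assms(1,2)]) auto
  ultimately show ?case
    using Suc.prems by (simp add: state_process_Suc Let_def del: state_process.simps(2))
qed simp

section \<open>The outcomes as a finite table\<close>

text \<open>The model together with an arbitrary rule \<open>sel\<close> selecting the arm to play.\<close>

locale bandit_play = bandit_model M A T n p W
  for M :: "'w measure" and A :: "'a set" and T n p W +
  fixes sel :: "nat \<Rightarrow> ('a \<Rightarrow> nat \<times> nat) \<Rightarrow> 'a"
  assumes finite_arms: "finite A"
    and initial: "n \<in> states A"
    and sel_arm: "t < T \<Longrightarrow> m \<in> states A \<Longrightarrow> sel t m \<in> A"
begin

abbreviation N where "N \<equiv> state_process (deco_policy sel) W n"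

text \<open>All outcomes \<open>W a t\<close>, for \<open>a \<in> A\<close> and \<open>1 \<le> t \<le> T\<close>, are gathered in one random element \<open>table\<close> of
  the finite set \<open>tables\<close> of extensional functions on \<open>slots\<close>.\<close>

definition slots where "slots = A \<times> {1..T}"

definition tables :: "('a \<times> nat \<Rightarrow> outcome) set" where "tables = slots \<rightarrow>\<^sub>E UNIV"

definition table where "table \<omega> = (\<lambda>(a, t)\<in>slots. W a t \<omega>)"

text \<open>The state at time \<open>t\<close> as a deterministic function of the table of outcomes.\<close>

definition replay where
  "replay t w = state_process (deco_policy sel) (\<lambda>a s w. w (a, s)) n t w"

text \<open>A finite set that contains all values of the state at time \<open>t \<le> T\<close>.\<close>

definition reachable where "reachable t = replay t ` tables"

lemma finite_slots: "finite slots"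
  using finite_arms by (simp add: slots_def)

lemma finite_tables: "finite tables"
  using finite_slots by (auto simp: tables_def intro!: finite_PiE)

lemma table_in_tables: "table \<omega> \<in> tables"
  by (auto simp: table_def tables_def)

lemma N_in_states: "t \<le> T \<Longrightarrow> N t \<omega> \<in> states A"
  by (intro state_process_in_states[OF initial sel_arm])

lemma N_eq_replay: "t \<le> T \<Longrightarrow> N t \<omega> = replay t (table \<omega>)"
  unfolding replay_def
  by (rule state_process_cong[OF initial sel_arm]) (auto simp: table_def slots_def)

lemma finite_reachable: "finite (reachable t)"
  by (simp add: reachable_def finite_tables)

lemma N_reachable: "t \<le> T \<Longrightarrow> N t \<omega> \<in> reachable t"
  by (simp add: N_eq_replay reachable_def table_in_tables)

lemma reachable_in_states: "t \<le> T \<Longrightarrow> reachable t \<subseteq> states A"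
  unfolding reachable_def replay_def
  by (auto intro!: state_process_in_states[OF initial sel_arm])

lemma replay_upd: "t \<le> T \<Longrightarrow> t < s \<Longrightarrow> replay t (w((a, s) := y)) = replay t w"
  unfolding replay_def
  by (rule state_process_cong[OF initial sel_arm]) auto

lemma initial_pos: "a \<in> A \<Longrightarrow> fst (n a) > 0" "a \<in> A \<Longrightarrow> snd (n a) > 0"
  using initial by (auto simp: states_def PiE_iff mem_Times_iff Suc_le_eq)

section \<open>Monomials in the parameters\<close>

lemma param_measurable [measurable]: "a \<in> A \<Longrightarrow> p a x \<in> borel_measurable M"
proof -
  assume a: "a \<in> A"
  have Bad: "p a Bad \<in> borel_measurable M"
    using params_beta[OF a] by (simp add: distributed_def)
  have "(\<lambda>\<omega>. 1 - p a Bad \<omega>) \<in> borel_measurable M" using Bad by simp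
  moreover have "1 - p a Bad \<omega> = p a Good \<omega>" if "\<omega> \<in> space M" for \<omega>
    using params_sum[OF a that] by simp
  ultimately have "p a Good \<in> borel_measurable M"
    by (simp cong: measurable_cong)
  with Bad show ?thesis by (cases x) auto
qed

lemma params_vector_measurable: "(\<lambda>\<omega>. \<lambda>a\<in>A. p a Bad \<omega>) \<in> M \<rightarrow>\<^sub>M (\<Pi>\<^sub>M a\<in>A. borel)"
  by (rule measurable_restrict) auto

lemma param_subalgebra: "subalgebra M (param_algebra M A p)"
  unfolding subalgebra_def param_algebra_def
  using sets_image_in_sets[OF refl params_vector_measurable] by simp

sublocale params: finite_measure_subalgebra M "param_algebra M A p"
  by unfold_locales (rule param_subalgebra)

lemma param_measurable_params [measurable]:
  "a \<in> A \<Longrightarrow> p a x \<in> borel_measurable (param_algebra M A p)"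
proof -
  assume a: "a \<in> A"
  let ?F = "param_algebra M A p"
  have sp: "space ?F = space M" by (simp add: param_algebra_def)
  have "(\<lambda>\<omega>. \<lambda>a\<in>A. p a Bad \<omega>) \<in> ?F \<rightarrow>\<^sub>M (\<Pi>\<^sub>M a\<in>A. borel)"
    unfolding param_algebra_def
    by (rule measurable_vimage_algebra1) (auto simp: space_PiM)
  from measurable_compose[OF this measurable_component_singleton[OF a]]
  have Bad: "p a Bad \<in> borel_measurable ?F" using a by simp
  have "(\<lambda>\<omega>. 1 - p a Bad \<omega>) \<in> borel_measurable ?F" using Bad by simp
  moreover have "1 - p a Bad \<omega> = p a Good \<omega>" if "\<omega> \<in> space ?F" for \<omega>
    using params_sum[OF a] that by (simp add: sp algebra_simps)
  ultimately have "p a Good \<in> borel_measurable ?F"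
    by (simp cong: measurable_cong)
  with Bad show ?thesis by (cases x) auto
qed

text \<open>The monomial in all parameters \<open>p a x\<close> with exponents \<open>e a x\<close>.\<close>

definition monomial where
  "monomial e \<omega> = (\<Prod>a\<in>A. p a Bad \<omega> ^ e a Bad * p a Good \<omega> ^ e a Good)"

lemma monomial_measurable_params [measurable]: "monomial e \<in> borel_measurable (param_algebra M A p)"
  unfolding monomial_def by measurable

lemma monomial_moment:
  shows "integrable M (monomial e)"
    and "expectation (monomial e) =
      (\<Prod>a\<in>A. Beta (real (fst (n a)) + real (e a Bad)) (real (snd (n a)) + real (e a Good))
               / Beta (real (fst (n a))) (real (snd (n a))))"
proof -
  let ?X = "\<lambda>a \<omega>. p a Bad \<omega> ^ e a Bad * (1 - p a Bad \<omega>) ^ e a Good"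
  have eq: "monomial e \<omega> = (\<Prod>a\<in>A. ?X a \<omega>)" if "\<omega> \<in> space M" for \<omega>
    unfolding monomial_def
  proof (intro prod.cong refl)
    fix a assume "a \<in> A"
    then have "p a Good \<omega> = 1 - p a Bad \<omega>"
      using params_sum[OF _ that, of a] by simp
    then show "p a Bad \<omega> ^ e a Bad * p a Good \<omega> ^ e a Good = ?X a \<omega>" by simp
  qed
  have indep: "indep_vars (\<lambda>_. borel) ?X A"
    by (rule indep_vars_compose2[OF params_indep]) simp
  have int: "integrable M (?X a)" 
    and moment: "expectation (?X a) = Beta (real (fst (n a)) + real (e a Bad)) (real (snd (n a)) + real (e a Good))
               / Beta (real (fst (n a))) (real (snd (n a)))" if "a \<in> A" for a
  proof -
    note pos = initial_pos[OF that]
    note d = params_beta[OF that]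
    have nn: "0 \<le> beta_density (fst (n a)) (snd (n a)) x" for x
      using pos by (intro beta_density_nonneg) auto
    show "integrable M (?X a)"
      using distributed_integrable[OF d, of "\<lambda>x. x ^ e a Bad * (1 - x) ^ e a Good"] nn
        beta_density_moment(1)[of "fst (n a)" "snd (n a)"] pos by simp
    show "expectation (?X a) = Beta (real (fst (n a)) + real (e a Bad)) (real (snd (n a)) + real (e a Good))
               / Beta (real (fst (n a))) (real (snd (n a)))"
      using distributed_integral[OF d, of "\<lambda>x. x ^ e a Bad * (1 - x) ^ e a Good"] nn
        beta_density_moment(2)[of "fst (n a)" "snd (n a)" "e a Bad" "e a Good"] pos by simp
  qed
  show "integrable M (monomial e)"
    using indep_vars_integrable[OF finite_arms indep int] eq
    by (subst Bochner_Integration.integrable_cong[OF refl eq])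
  show "expectation (monomial e) =
      (\<Prod>a\<in>A. Beta (real (fst (n a)) + real (e a Bad)) (real (snd (n a)) + real (e a Good))
               / Beta (real (fst (n a))) (real (snd (n a))))"
    using indep_vars_lebesgue_integral[OF finite_arms indep int] eq moment
    by (simp cong: Bochner_Integration.integral_cong)
qed

section \<open>Law of the table of outcomes\<close>

lemma table_measurable [measurable]: "table \<in> M \<rightarrow>\<^sub>M count_space tables"
proof (rule measurable_count_space_eq2[THEN iffD2, OF finite_tables], intro conjI ballI)
  show "table \<in> space M \<rightarrow> tables" using table_in_tables by auto
  fix w assume w: "w \<in> tables"
  have "table \<omega> = w \<longleftrightarrow> (\<forall>i\<in>slots. W (fst i) (snd i) \<omega> = w i)" for \<omega>
    using w by (auto simp: table_def tables_def fun_eq_iff PiE_iff extensional_def)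
  then have "table -` {w} \<inter> space M = {\<omega> \<in> space M. \<forall>i\<in>slots. W (fst i) (snd i) \<omega> = w i}"
    by auto
  also have "\<dots> \<in> sets M"
  proof (rule sets.sets_Collect_finite_All[OF _ finite_slots])
    fix i assume "i \<in> slots"
    then have "W (fst i) (snd i) \<in> M \<rightarrow>\<^sub>M count_space UNIV"
      by (intro outcomes_measurable) (auto simp: slots_def)
    then show "{\<omega> \<in> space M. W (fst i) (snd i) \<omega> = w i} \<in> sets M"
      by measurable
  qed
  finally show "table -` {w} \<inter> space M \<in> sets M" .
qed

lemma integrable_mult_table:
  fixes g :: "_ \<Rightarrow> real"
  assumes "integrable M H"
  shows "integrable M (\<lambda>\<omega>. H \<omega> * g (table \<omega>))"
proof (rule Bochner_Integration.integrable_bound)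
  show "integrable M (\<lambda>\<omega>. H \<omega> * (\<Sum>w\<in>tables. \<bar>g w\<bar>))" using assms by simp
  have "(\<lambda>\<omega>. g (table \<omega>)) \<in> borel_measurable M"
    by (rule measurable_compose[OF table_measurable]) simp
  then show "(\<lambda>\<omega>. H \<omega> * g (table \<omega>)) \<in> borel_measurable M"
    using assms by measurable
  have "\<bar>g (table \<omega>)\<bar> \<le> (\<Sum>w\<in>tables. \<bar>g w\<bar>)" for \<omega>
    using finite_tables table_in_tables by (intro member_le_sum) auto
  then show "AE \<omega> in M. norm (H \<omega> * g (table \<omega>)) \<le> norm (H \<omega> * (\<Sum>w\<in>tables. \<bar>g w\<bar>))"
    by (auto simp: abs_mult sum_nonneg intro!: mult_left_mono)
qed

lemma integrable_table: "integrable M (\<lambda>\<omega>. g (table \<omega>) :: real)"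
  using integrable_mult_table[of "\<lambda>_. 1" g] by simp

lemma integrable_N: "t \<le> T \<Longrightarrow> integrable M (\<lambda>\<omega>. g (N t \<omega>) :: real)"
  using integrable_table[of "\<lambda>w. g (replay t w)"] by (simp add: N_eq_replay)

text \<open>The conditional law of the table given the parameters, tested against a function \<open>H\<close> of the
  parameters.\<close>

lemma table_law:
  assumes [measurable]: "H \<in> borel_measurable (param_algebra M A p)" and H: "integrable M H"
    and w: "w \<in> tables"
  shows "integrable M (\<lambda>\<omega>. H \<omega> * (\<Prod>i\<in>slots. p (fst i) (w i) \<omega>))"
    and "(\<integral>\<omega>. H \<omega> * of_bool (table \<omega> = w) \<partial>M) = (\<integral>\<omega>. H \<omega> * (\<Prod>i\<in>slots. p (fst i) (w i) \<omega>) \<partial>M)"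
proof -
  let ?E = "{\<omega> \<in> space M. \<forall>a\<in>A. \<forall>t\<in>{1..T}. W a t \<omega> = w (a, t)}"
  let ?F = "param_algebra M A p"
  have ind: "indicator ?E \<omega> = of_bool (table \<omega> = w)" if "\<omega> \<in> space M" for \<omega>
  proof -
    have "table \<omega> = w \<longleftrightarrow> (\<forall>i\<in>slots. W (fst i) (snd i) \<omega> = w i)"
      using w by (auto simp: table_def tables_def fun_eq_iff PiE_iff extensional_def)
    then show ?thesis
      using that by (auto simp: slots_def indicator_def)
  qed
  have int: "integrable M (\<lambda>\<omega>. H \<omega> * of_bool (table \<omega> = w))"
    by (rule integrable_mult_table[OF H])
  then have int': "integrable M (\<lambda>\<omega>. H \<omega> * indicator ?E \<omega>)"
    by (rule Bochner_Integration.integrable_cong[THEN iffD1, rotated -1]) (simp_all only: ind)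
  have "(\<lambda>\<omega>. of_bool (table \<omega> = w) :: real) \<in> borel_measurable M"
    using integrable_table[of "\<lambda>v. of_bool (v = w)"] by simp
  then have meas: "(indicator ?E :: _ \<Rightarrow> real) \<in> borel_measurable M"
    by (subst measurable_cong[OF ind])
  have prod: "(\<Prod>a\<in>A. \<Prod>t=1..T. p a (w (a, t)) \<omega>) = (\<Prod>i\<in>slots. p (fst i) (w i) \<omega>)" for \<omega>
    by (simp add: slots_def prod.cartesian_product case_prod_unfold)
  \<comment> \<open>the conditional probability of the event \<open>table = w\<close> is the product of the parameters\<close>
  have ae: "AE \<omega> in M. H \<omega> * real_cond_exp M ?F (indicator ?E) \<omega> = H \<omega> * (\<Prod>i\<in>slots. p (fst i) (w i) \<omega>)"
    using outcomes[of "\<lambda>a t. w (a, t)"] by eventually_elim (simp only: prod)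
  have [measurable]: "H \<in> borel_measurable M" using H by simp
  have m: "(\<lambda>\<omega>. H \<omega> * (\<Prod>i\<in>slots. p (fst i) (w i) \<omega>)) \<in> borel_measurable M"
    by (intro borel_measurable_times borel_measurable_prod param_measurable) (auto simp: slots_def)
  note ce = params.real_cond_exp_intg[OF int' assms(1) meas]
  have m': "(\<lambda>\<omega>. H \<omega> * real_cond_exp M ?F (indicator ?E) \<omega>) \<in> borel_measurable M"
    using ce(1) by simp
  show "integrable M (\<lambda>\<omega>. H \<omega> * (\<Prod>i\<in>slots. p (fst i) (w i) \<omega>))"
    using ce(1) integrable_cong_AE[OF m' m ae] by simp
  have "(\<integral>\<omega>. H \<omega> * of_bool (table \<omega> = w) \<partial>M) = (\<integral>\<omega>. H \<omega> * indicator ?E \<omega> \<partial>M)"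
    by (rule Bochner_Integration.integral_cong) (simp_all only: ind)
  also have "\<dots> = (\<integral>\<omega>. H \<omega> * (\<Prod>i\<in>slots. p (fst i) (w i) \<omega>) \<partial>M)"
    using ce(2) integral_cong_AE[OF m' m ae] by simp
  finally show "(\<integral>\<omega>. H \<omega> * of_bool (table \<omega> = w) \<partial>M) = (\<integral>\<omega>. H \<omega> * (\<Prod>i\<in>slots. p (fst i) (w i) \<omega>) \<partial>M)" .
qed

lemma table_expectation:
  assumes [measurable]: "H \<in> borel_measurable (param_algebra M A p)" and H: "integrable M H"
  shows "(\<integral>\<omega>. H \<omega> * g (table \<omega>) \<partial>M)
    = (\<integral>\<omega>. H \<omega> * (\<Sum>w\<in>tables. g w * (\<Prod>i\<in>slots. p (fst i) (w i) \<omega>)) \<partial>M)"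
proof -
  have g: "g (table \<omega>) = (\<Sum>w\<in>tables. g w * of_bool (table \<omega> = w))" for \<omega>
    using finite_tables table_in_tables[of \<omega>]
    by (simp add: of_bool_def if_distrib[of "\<lambda>z. g _ * z"] eq_commute cong: if_cong)
  have "(\<integral>\<omega>. H \<omega> * g (table \<omega>) \<partial>M) = (\<integral>\<omega>. (\<Sum>w\<in>tables. g w * (H \<omega> * of_bool (table \<omega> = w))) \<partial>M)"
    by (subst g) (simp add: sum_distrib_left mult_ac)
  also have "\<dots> = (\<Sum>w\<in>tables. g w * (\<integral>\<omega>. H \<omega> * of_bool (table \<omega> = w) \<partial>M))"
    using integrable_mult_table[OF H, of "\<lambda>v. of_bool (v = _)"] by simp
  also have "\<dots> = (\<Sum>w\<in>tables. g w * (\<integral>\<omega>. H \<omega> * (\<Prod>i\<in>slots. p (fst i) (w i) \<omega>) \<partial>M))"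
    using table_law[OF assms] by simp
  also have "\<dots> = (\<integral>\<omega>. (\<Sum>w\<in>tables. g w * (H \<omega> * (\<Prod>i\<in>slots. p (fst i) (w i) \<omega>))) \<partial>M)"
    using table_law[OF assms] by simp
  also have "\<dots> = (\<integral>\<omega>. H \<omega> * (\<Sum>w\<in>tables. g w * (\<Prod>i\<in>slots. p (fst i) (w i) \<omega>)) \<partial>M)"
    by (simp add: sum_distrib_left mult_ac)
  finally show ?thesis .
qed

text \<open>Conditionally on the parameters, the next outcome of an arm is independent of the current state,
  which depends on outcomes up to time \<open>t\<close> only.\<close>

lemma next_outcome_given_params:
  assumes H: "H \<in> borel_measurable (param_algebra M A p)" "integrable M H"
    and H': "integrable M (\<lambda>\<omega>. p a x \<omega> * H \<omega>)"
    and "a \<in> A" "t < T"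
  shows "(\<integral>\<omega>. H \<omega> * of_bool (N t \<omega> = m \<and> W a (Suc t) \<omega> = x) \<partial>M)
    = (\<integral>\<omega>. p a x \<omega> * H \<omega> * of_bool (N t \<omega> = m) \<partial>M)"
proof -
  let ?i = "(a, Suc t)" and ?g = "\<lambda>w. of_bool (replay t w = m) :: real"
  let ?Q = "\<lambda>w \<omega>. \<Prod>i\<in>slots. p (fst i) (w i) \<omega>"
  have i: "?i \<in> slots" using assms by (auto simp: slots_def)
  have "(\<integral>\<omega>. H \<omega> * of_bool (N t \<omega> = m \<and> W a (Suc t) \<omega> = x) \<partial>M)
      = (\<integral>\<omega>. H \<omega> * (?g (table \<omega>) * of_bool (table \<omega> ?i = x)) \<partial>M)"
    using i assms(5) by (simp add: N_eq_replay table_def of_bool_conj)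
  also have "\<dots> = (\<integral>\<omega>. H \<omega> * (\<Sum>w\<in>tables. ?g w * of_bool (w ?i = x) * ?Q w \<omega>) \<partial>M)"
    using table_expectation[OF H, of "\<lambda>w. ?g w * of_bool (w ?i = x)"] by simp
  also have "\<dots> = (\<integral>\<omega>. H \<omega> * (p a x \<omega> * (\<Sum>w\<in>tables. ?g w * ?Q w \<omega>)) \<partial>M)"
  proof (intro Bochner_Integration.integral_cong refl arg_cong2[where f="(*)"])
    fix \<omega> assume "\<omega> \<in> space M"
    then have q: "p (fst ?i) Bad \<omega> + p (fst ?i) Good \<omega> = 1"
      using params_sum assms(4) by simp
    have g: "?g (w(?i := y)) = ?g w" for w y
      using assms(5) by (simp add: replay_upd)
    show "(\<Sum>w\<in>tables. ?g w * of_bool (w ?i = x) * ?Q w \<omega>) = p a x \<omega> * (\<Sum>w\<in>tables. ?g w * ?Q w \<omega>)"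
      unfolding tables_def
      using product_weight_condition[of slots ?i "\<lambda>i y. p (fst i) y \<omega>" ?g x, OF finite_slots i q g]
      by simp
  qed
  also have "\<dots> = (\<integral>\<omega>. (p a x \<omega> * H \<omega>) * (\<Sum>w\<in>tables. ?g w * ?Q w \<omega>) \<partial>M)"
    by (simp add: mult_ac)
  also have "\<dots> = (\<integral>\<omega>. (p a x \<omega> * H \<omega>) * ?g (table \<omega>) \<partial>M)"
    using H(1) param_measurable_params[OF assms(4), of x]
    by (intro table_expectation[OF _ H', symmetric] borel_measurable_times)
  finally show ?thesis
    using assms(5) by (simp add: N_eq_replay)
qed

section \<open>The next outcome given the current state\<close>

text \<open>The joint normalising constant of the Beta densities with counts \<open>m + e\<close>.\<close>

definition beta_weight where
  "beta_weight m e = (\<Prod>a\<in>A. Beta (real (fst (m a) + e a Bad)) (real (snd (m a) + e a Good)))"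

text \<open>The exponents of the product of a monomial by \<open>p a x\<close>.\<close>

definition bump :: "('a \<Rightarrow> outcome \<Rightarrow> nat) \<Rightarrow> 'a \<Rightarrow> outcome \<Rightarrow> 'a \<Rightarrow> outcome \<Rightarrow> nat" where
  "bump e a x = e(a := (e a)(x := Suc (e a x)))"

lemma monomial_bump: "a \<in> A \<Longrightarrow> monomial (bump e a x) \<omega> = p a x \<omega> * monomial e \<omega>"
  unfolding monomial_def using finite_arms
  by (cases x) (simp_all add: prod.remove[of A a] bump_def mult_ac)

lemma beta_weight_observe: "beta_weight (observe m a x) e = beta_weight m (bump e a x)"
  unfolding beta_weight_def
  by (rule prod.cong; cases x) (auto simp: observe_def bump_def ac_simps)

lemma beta_weight_bump_zero:
  assumes "m \<in> states A" "a \<in> A"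
  shows "beta_weight m (bump (\<lambda>_ _. 0) a x) = posterior_mean (m a) x * beta_weight m (\<lambda>_ _. 0)"
proof -
  have pos: "fst (m a) > 0" "snd (m a) > 0"
    using assms by (auto simp: states_def PiE_iff mem_Times_iff Suc_le_eq)
  show ?thesis
    using assms(2) finite_arms pos Beta_plus1_left_fraction[of "fst (m a)" "snd (m a)"] Beta_plus1_right_fraction[of "fst (m a)" "snd (m a)"]
    by (cases x)
      (simp_all add: beta_weight_def prod.remove[of A a] bump_def posterior_mean_def add.commute mult_ac)
qed

lemma N_Suc_of_bool:
  assumes "t < T"
  shows "of_bool (N (Suc t) \<omega> = m') = (\<Sum>m\<in>reachable t. \<Sum>x\<in>UNIV.
    of_bool (observe m (sel t m) x = m') * (of_bool (N t \<omega> = m \<and> W (sel t m) (Suc t) \<omega> = x) :: real))"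
proof -
  let ?m = "N t \<omega>"
  have "(\<Sum>m\<in>reachable t. \<Sum>x\<in>UNIV.
      of_bool (observe m (sel t m) x = m') * (of_bool (?m = m \<and> W (sel t m) (Suc t) \<omega> = x) :: real))
    = (\<Sum>m\<in>reachable t. if m = ?m then of_bool (observe m (sel t m) (W (sel t m) (Suc t) \<omega>) = m') else 0)"
    by (simp add: sum_outcome_match eq_commute[of _ "N t \<omega>"] cong: if_cong)
  also have "\<dots> = of_bool (N (Suc t) \<omega> = m')"
    using N_reachable[of t \<omega>] assms finite_reachable[of t]
    by (simp add: state_process_Suc Let_def del: state_process.simps(2))
  finally show ?thesis by simp
qed

text \<open>The constant \<open>c\<close> may depend on \<open>t\<close> and \<open>m\<close> but not on \<open>e\<close>. All monomials are treated at once
  because conditioning on the next outcome multiplies the monomial by a parameter.\<close>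

lemma state_monomial_moment:
  assumes "t \<le> T"
  shows "\<exists>c. \<forall>e. (\<integral>\<omega>. monomial e \<omega> * of_bool (N t \<omega> = m) \<partial>M) = c * beta_weight m e"
  using assms
proof (induction t arbitrary: m)
  case 0
  show ?case
  proof (cases "m = n")
    case True
    \<comment> \<open>\<open>c\<close> is the reciprocal of the normalising constant of the prior\<close>
    then show ?thesis
      by (intro exI[of _ "\<Prod>a\<in>A. 1 / Beta (real (fst (n a))) (real (snd (n a)))"])
        (simp add: monomial_moment beta_weight_def prod.distrib[symmetric])
  qed auto
next
  case (Suc t)
  then have t: "t < T" "t \<le> T" by auto
  obtain c where c: "\<And>m e. (\<integral>\<omega>. monomial e \<omega> * of_bool (N t \<omega> = m) \<partial>M) = c m * beta_weight m e"
    using Suc.IH[OF t(2)] by metis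
  have int: "integrable M (\<lambda>\<omega>. monomial e \<omega> * of_bool (N t \<omega> = m \<and> W a (Suc t) \<omega> = x))" if "a \<in> A" for e m a x
    using integrable_mult_table[OF monomial_moment(1)[of e], of "\<lambda>w. of_bool (replay t w = m \<and> w (a, Suc t) = x)"]
      that t by (simp add: N_eq_replay table_def slots_def)
  have step: "(\<integral>\<omega>. monomial e \<omega> * of_bool (N t \<omega> = m \<and> W a (Suc t) \<omega> = x) \<partial>M)
      = c m * beta_weight (observe m a x) e" if "a \<in> A" for e m a x
  proof -
    have "integrable M (\<lambda>\<omega>. p a x \<omega> * monomial e \<omega>)"
      using monomial_moment(1)[of "bump e a x"] that by (simp add: monomial_bump[OF that, abs_def])
    from next_outcome_given_params[OF monomial_measurable_params monomial_moment(1) this that t(1)]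
    show ?thesis
      by (simp add: monomial_bump[OF that, symmetric] c beta_weight_observe)
  qed
  have arm: "sel t m \<in> A" if "m \<in> reachable t" for m
    using reachable_in_states[OF t(2)] sel_arm[OF t(1)] that by auto
  have "(\<integral>\<omega>. monomial e \<omega> * of_bool (N (Suc t) \<omega> = m) \<partial>M)
    = (\<Sum>m'\<in>reachable t. \<Sum>x\<in>UNIV. of_bool (observe m' (sel t m') x = m) * c m') * beta_weight m e" for e
  proof -
    have "(\<integral>\<omega>. monomial e \<omega> * of_bool (N (Suc t) \<omega> = m) \<partial>M)
      = (\<integral>\<omega>. (\<Sum>m'\<in>reachable t. \<Sum>x\<in>UNIV. of_bool (observe m' (sel t m') x = m) *
          (monomial e \<omega> * of_bool (N t \<omega> = m' \<and> W (sel t m') (Suc t) \<omega> = x))) \<partial>M)"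
      unfolding N_Suc_of_bool[OF t(1), of _ m] sum_distrib_left
      by (intro Bochner_Integration.integral_cong sum.cong refl) (rule mult.left_commute)
    also have "\<dots> = (\<Sum>m'\<in>reachable t. \<Sum>x\<in>UNIV. of_bool (observe m' (sel t m') x = m) *
          (\<integral>\<omega>. monomial e \<omega> * of_bool (N t \<omega> = m' \<and> W (sel t m') (Suc t) \<omega> = x) \<partial>M))"
      using int[OF arm] by simp
    also have "\<dots> = (\<Sum>m'\<in>reachable t. \<Sum>x\<in>UNIV. of_bool (observe m' (sel t m') x = m) * (c m' * beta_weight m e))"
    proof (intro sum.cong refl)
      fix m' x assume "m' \<in> reachable t"
      then show "of_bool (observe m' (sel t m') x = m) *
          (\<integral>\<omega>. monomial e \<omega> * of_bool (N t \<omega> = m' \<and> W (sel t m') (Suc t) \<omega> = x) \<partial>M)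
        = of_bool (observe m' (sel t m') x = m) * (c m' * beta_weight m e)"
        by (cases "observe m' (sel t m') x = m") (simp_all only: step[OF arm] of_bool_eq mult_zero_left)
    qed
    finally show ?thesis by (simp only: sum_distrib_right mult.assoc)
  qed
  then show ?case by blast
qed

lemma next_outcome_given_state:
  assumes "t < T" "m \<in> states A" "a \<in> A"
  shows "(\<integral>\<omega>. of_bool (N t \<omega> = m \<and> W a (Suc t) \<omega> = x) \<partial>M)
    = posterior_mean (m a) x * (\<integral>\<omega>. of_bool (N t \<omega> = m) \<partial>M)"
proof -
  let ?z = "\<lambda>_ _. 0 :: nat"
  have one: "monomial ?z \<omega> = 1" for \<omega> by (simp add: monomial_def)
  obtain c where c: "\<And>e. (\<integral>\<omega>. monomial e \<omega> * of_bool (N t \<omega> = m) \<partial>M) = c * beta_weight m e"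
    using state_monomial_moment[of t m] assms by auto
  \<comment> \<open>the exponents \<open>?z\<close> and \<open>bump ?z a x\<close> give two expectations with the same factor \<open>c\<close>\<close>
  have "integrable M (\<lambda>\<omega>. p a x \<omega> * monomial ?z \<omega>)"
    using monomial_moment(1)[of "bump ?z a x"] by (simp add: monomial_bump[OF assms(3), abs_def])
  from next_outcome_given_params[OF monomial_measurable_params monomial_moment(1) this assms(3,1)]
  have "(\<integral>\<omega>. of_bool (N t \<omega> = m \<and> W a (Suc t) \<omega> = x) \<partial>M) = c * beta_weight m (bump ?z a x)"
    using c[of "bump ?z a x"] by (simp add: monomial_bump[OF assms(3)] one)
  then show ?thesis
    using beta_weight_bump_zero[OF assms(2,3)] c[of ?z] by (simp add: one)
qed

text \<open>One step of the state process, averaged over the outcome of the arm played.\<close>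

lemma expectation_step:
  fixes f :: "('a \<Rightarrow> nat \<times> nat) \<Rightarrow> outcome \<Rightarrow> real"
  assumes "t < T"
  shows "(\<integral>\<omega>. f (N t \<omega>) (W (sel t (N t \<omega>)) (Suc t) \<omega>) \<partial>M)
    = (\<integral>\<omega>. (\<Sum>x\<in>UNIV. posterior_mean (N t \<omega> (sel t (N t \<omega>))) x * f (N t \<omega>) x) \<partial>M)"
proof -
  have t: "t \<le> T" using assms by simp
  have arm: "sel t m \<in> A" if "m \<in> reachable t" for m
    using reachable_in_states[OF t] sel_arm[OF assms] that by auto
  have int: "integrable M (\<lambda>\<omega>. of_bool (N t \<omega> = m \<and> W a (Suc t) \<omega> = x) :: real)" if "a \<in> A" for m a x
    using integrable_table[of "\<lambda>w. of_bool (replay t w = m \<and> w (a, Suc t) = x)"]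
      that assms by (simp add: N_eq_replay table_def slots_def)
  have int': "integrable M (\<lambda>\<omega>. of_bool (N t \<omega> = m) :: real)" for m
    using integrable_N[OF t, of "\<lambda>m'. of_bool (m' = m)"] by simp
  have "f (N t \<omega>) (W (sel t (N t \<omega>)) (Suc t) \<omega>)
      = (\<Sum>m\<in>reachable t. if m = N t \<omega> then f m (W (sel t m) (Suc t) \<omega>) else 0)" for \<omega>
    using N_reachable[OF t, of \<omega>] finite_reachable[of t] by simp
  also have "(\<Sum>m\<in>reachable t. if m = N t \<omega> then f m (W (sel t m) (Suc t) \<omega>) else 0)
      = (\<Sum>m\<in>reachable t. \<Sum>x\<in>UNIV. f m x * of_bool (N t \<omega> = m \<and> W (sel t m) (Suc t) \<omega> = x))" for \<omega>
    by (simp add: sum_outcome_match eq_commute[of _ "N t \<omega>"] cong: if_cong)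
  finally have "(\<integral>\<omega>. f (N t \<omega>) (W (sel t (N t \<omega>)) (Suc t) \<omega>) \<partial>M)
    = (\<Sum>m\<in>reachable t. \<Sum>x\<in>UNIV. f m x * (\<integral>\<omega>. of_bool (N t \<omega> = m \<and> W (sel t m) (Suc t) \<omega> = x) \<partial>M))"
    using int[OF arm] by (simp del: sum_of_bool_mult_eq sum_mult_of_bool_eq)
  also have "\<dots> = (\<Sum>m\<in>reachable t. \<Sum>x\<in>UNIV. f m x * (posterior_mean (m (sel t m)) x * (\<integral>\<omega>. of_bool (N t \<omega> = m) \<partial>M)))"
    using reachable_in_states[OF t] arm by (intro sum.cong refl) (auto simp: next_outcome_given_state[OF assms])
  also have "\<dots> = (\<integral>\<omega>. (\<Sum>m\<in>reachable t. (\<Sum>x\<in>UNIV. posterior_mean (m (sel t m)) x * f m x) * of_bool (N t \<omega> = m)) \<partial>M)"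
    using int' by (simp add: sum_distrib_left mult_ac)
  also have "\<dots> = (\<integral>\<omega>. (\<Sum>x\<in>UNIV. posterior_mean (N t \<omega> (sel t (N t \<omega>))) x * f (N t \<omega>) x) \<partial>M)"
  proof (intro Bochner_Integration.integral_cong refl)
    fix \<omega>
    have "(\<Sum>m\<in>reachable t. h m * of_bool (N t \<omega> = m)) = h (N t \<omega>)" for h :: "_ \<Rightarrow> real"
      using N_reachable[OF t, of \<omega>] finite_reachable[of t]
      by (simp add: of_bool_def if_distrib[of "\<lambda>z. h _ * z"] cong: if_cong)
    then show "(\<Sum>m\<in>reachable t. (\<Sum>x\<in>UNIV. posterior_mean (m (sel t m)) x * f m x) * of_bool (N t \<omega> = m))
      = (\<Sum>x\<in>UNIV. posterior_mean (N t \<omega> (sel t (N t \<omega>))) x * f (N t \<omega>) x)" by simp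
  qed
  finally show ?thesis .
qed

section \<open>Telescoping the potential\<close>

lemma arm_value_step:
  "t < T \<Longrightarrow> arm_value L T \<mu> a t s = arm_value L T \<mu> a (Suc t) s + max (arm_index L T \<mu> a t s - \<mu> t) 0"
  by (subst arm_value.simps) (simp add: arm_index_def max_def)

text \<open>The part of the relaxed value from time \<open>t\<close> on that depends on the state \<open>m\<close>.\<close>

definition potential where
  "potential L \<mu> t m = (\<Sum>a\<in>A. arm_value L T \<mu> a t (m a))"

lemma potential_observe:
  assumes "m \<in> states A" "a \<in> A"
  shows "(\<Sum>x\<in>UNIV. posterior_mean (m a) x * potential L \<mu> (Suc t) (observe m a x))
    = potential L \<mu> (Suc t) m + arm_index L T \<mu> a t (m a) - mean_reward L a t (m a)"
proof -
  let ?V = "\<lambda>a. arm_value L T \<mu> a (Suc t)"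
  have sum1: "posterior_mean (m a) Good = 1 - posterior_mean (m a) Bad"
    using posterior_mean_sum[of "m a"] assms by (auto simp: states_def PiE_iff)
  have obs: "potential L \<mu> (Suc t) (observe m a x)
    = potential L \<mu> (Suc t) m - ?V a (m a) + ?V a (observe m a x a)" for x
    using assms(2) finite_arms by (simp add: potential_def sum.remove[of A a] observe_def)
  show ?thesis
    unfolding obs arm_index_def predict_eq
    by (simp add: outcome_UNIV sum1 observe_def algebra_simps)
qed

text \<open>The summand at time \<open>t\<close> is the conditional expectation of the one-step loss; the terms with
  negative \<open>I\<^sub>t\<^sup>a - \<mu>\<^sub>t\<close> vanish in the positive part, hence the restriction to \<^const>\<open>above_arms\<close>.\<close>

lemma potential_drop:
  assumes "t < T" "m \<in> states A"
  shows "potential L \<mu> t m + \<mu> t - mean_reward L (sel t m) t (m (sel t m))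
      - (\<Sum>x\<in>UNIV. posterior_mean (m (sel t m)) x * potential L \<mu> (Suc t) (observe m (sel t m) x))
    = max (\<mu> t - arm_index L T \<mu> (sel t m) t (m (sel t m))) 0
      + (\<Sum>a\<in>above_arms L A T \<mu> sel t m. arm_index L T \<mu> a t (m a) - \<mu> t)"
proof -
  let ?I = "\<lambda>a. arm_index L T \<mu> a t (m a)" and ?a = "sel t m"
  have a: "?a \<in> A" using assms sel_arm by simp
  have "potential L \<mu> t m = potential L \<mu> (Suc t) m + (\<Sum>a\<in>A. max (?I a - \<mu> t) 0)"
    by (simp add: potential_def arm_value_step[OF assms(1)] sum.distrib)
  moreover have "(\<Sum>a\<in>A. max (?I a - \<mu> t) 0) = max (?I ?a - \<mu> t) 0 + (\<Sum>a\<in>A - {?a}. max (?I a - \<mu> t) 0)"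
    using a finite_arms by (simp add: sum.remove)
  moreover have "(\<Sum>a\<in>A - {?a}. max (?I a - \<mu> t) 0) = (\<Sum>a\<in>above_arms L A T \<mu> sel t m. ?I a - \<mu> t)"
    using finite_arms
    by (intro sum.mono_neutral_cong_right) (auto simp: above_arms_def max_def)
  ultimately show ?thesis
    using potential_observe[OF assms(2) a, of L \<mu> t] by simp
qed

lemma played_reward:
  assumes "t < T"
  shows "(\<Sum>a\<in>A. mean_reward L a t (N t \<omega> a) * real (deco_policy sel t (N t \<omega>) a))
    = mean_reward L (sel t (N t \<omega>)) t (N t \<omega> (sel t (N t \<omega>)))"
proof -
  have "sel t (N t \<omega>) \<in> A" using assms by (intro sel_arm N_in_states) auto
  then show ?thesis
    using finite_arms by (simp add: deco_policy_def if_distrib[of real] if_distrib[of "(*) _"] cong: if_cong)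
qed

lemma suboptimality_gap:
  "relaxed_value L A T \<mu> n - policy_value M W L A T (deco_policy sel) n =
    (\<Sum>t<T. \<integral>\<omega>.
       max (\<mu> t - arm_index L T \<mu> (sel t (N t \<omega>)) t (N t \<omega> (sel t (N t \<omega>)))) 0
       + (\<Sum>a\<in>above_arms L A T \<mu> sel t (N t \<omega>). arm_index L T \<mu> a t (N t \<omega> a) - \<mu> t) \<partial>M)"
  (is "_ = (\<Sum>t<T. \<integral>\<omega>. ?gap t (N t \<omega>) \<partial>M)")
proof -
  let ?r = "\<lambda>t m. mean_reward L (sel t m) t (m (sel t m))"
  let ?P = "\<lambda>t. \<integral>\<omega>. potential L \<mu> t (N t \<omega>) \<partial>M"
  have step: "(\<integral>\<omega>. ?gap t (N t \<omega>) \<partial>M) = ?P t - ?P (Suc t) + \<mu> t - (\<integral>\<omega>. ?r t (N t \<omega>) \<partial>M)" if t: "t < T" for t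
  proof -
    let ?S = "\<lambda>m. \<Sum>x\<in>UNIV. posterior_mean (m (sel t m)) x * potential L \<mu> (Suc t) (observe m (sel t m) x)"
    have "(\<integral>\<omega>. ?gap t (N t \<omega>) \<partial>M)
      = (\<integral>\<omega>. potential L \<mu> t (N t \<omega>) + \<mu> t - ?r t (N t \<omega>) - ?S (N t \<omega>) \<partial>M)"
      using t by (intro Bochner_Integration.integral_cong refl potential_drop[symmetric] N_in_states) auto
    also have "\<dots> = ?P t + \<mu> t - (\<integral>\<omega>. ?r t (N t \<omega>) \<partial>M) - (\<integral>\<omega>. ?S (N t \<omega>) \<partial>M)"
    proof -
      note int = integrable_N[OF less_imp_le[OF t]]
      show ?thesis
        using int[of "potential L \<mu> t"] int[of "?r t"] int[of ?S] by (simp add: prob_space)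
    qed
    also have "(\<integral>\<omega>. ?S (N t \<omega>) \<partial>M) = ?P (Suc t)"
      using expectation_step[OF t, of "\<lambda>m x. potential L \<mu> (Suc t) (observe m (sel t m) x)"]
      by (simp add: state_process_Suc Let_def del: state_process.simps(2))
    finally show ?thesis by simp
  qed
  have "policy_value M W L A T (deco_policy sel) n = (\<integral>\<omega>. (\<Sum>t<T. ?r t (N t \<omega>)) \<partial>M)"
    unfolding policy_value_def
    by (intro Bochner_Integration.integral_cong refl sum.cong) (simp add: played_reward)
  also have "\<dots> = (\<Sum>t<T. \<integral>\<omega>. ?r t (N t \<omega>) \<partial>M)"
    by (intro Bochner_Integration.integral_sum integrable_N) auto
  finally have reward: "policy_value M W L A T (deco_policy sel) n = (\<Sum>t<T. \<integral>\<omega>. ?r t (N t \<omega>) \<partial>M)" .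
  have "(\<Sum>t<T. \<integral>\<omega>. ?gap t (N t \<omega>) \<partial>M)
      = (\<Sum>t<T. ?P t - ?P (Suc t) + \<mu> t - (\<integral>\<omega>. ?r t (N t \<omega>) \<partial>M))"
    by (intro sum.cong refl step) simp
  then have gaps: "(\<Sum>t<T. \<integral>\<omega>. ?gap t (N t \<omega>) \<partial>M)
      = (\<Sum>t<T. ?P t - ?P (Suc t)) + (\<Sum>t<T. \<mu> t) - (\<Sum>t<T. \<integral>\<omega>. ?r t (N t \<omega>) \<partial>M)"
    by (simp only: sum.distrib sum_subtractf)
  have "potential L \<mu> T m = 0" for m
    by (simp add: potential_def arm_value.simps)
  then have "(\<Sum>t<T. ?P t - ?P (Suc t)) = potential L \<mu> 0 n"
    using sum_lessThan_telescope'[of ?P T] by (simp add: prob_space del: state_process.simps(2))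
  then have "(\<Sum>t<T. \<integral>\<omega>. ?gap t (N t \<omega>) \<partial>M)
      = potential L \<mu> 0 n + (\<Sum>t<T. \<mu> t) - (\<Sum>t<T. \<integral>\<omega>. ?r t (N t \<omega>) \<partial>M)"
    by (simp only: gaps)
  then show ?thesis
    by (simp add: reward relaxed_value_def potential_def)
qed

end

theorem theorem6:
  fixes M :: "'w measure"
    and A :: "'a set" and T :: nat and n :: "'a \<Rightarrow> nat \<times> nat"
    and p :: "'a \<Rightarrow> outcome \<Rightarrow> 'w \<Rightarrow> real"
    and W :: "'a \<Rightarrow> nat \<Rightarrow> 'w \<Rightarrow> outcome"
    and L :: "'a \<Rightarrow> nat \<Rightarrow> outcome \<Rightarrow> real"
    and \<mu> :: "nat \<Rightarrow> real"
    and sel :: "nat \<Rightarrow> ('a \<Rightarrow> nat \<times> nat) \<Rightarrow> 'a"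
  assumes "finite A" and "A \<noteq> {}" and "T \<ge> 1"
    and "\<forall>t<T. \<mu> t \<ge> 0"
    and "n \<in> states A"
    and "bandit_model M A T n p W"
    and "deco_selection L A T \<mu> sel"
  defines "\<psi> \<equiv> deco_policy sel"
  defines "N \<equiv> state_process \<psi> W n"
  shows "relaxed_value L A T \<mu> n - policy_value M W L A T \<psi> n =
    (\<Sum>t<T. \<integral>\<omega>.
       max (\<mu> t - arm_index L T \<mu> (sel t (N t \<omega>)) t (N t \<omega> (sel t (N t \<omega>)))) 0
       + (\<Sum>a\<in>above_arms L A T \<mu> sel t (N t \<omega>). arm_index L T \<mu> a t (N t \<omega> a) - \<mu> t) \<partial>M)"
proof -
  interpret bandit_model M A T n p W by fact
  interpret bandit_play M A T n p W sel
    using assms(1,5,7) by unfold_locales (auto simp: deco_selection_def is_arg_max_def)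
  show ?thesis
    unfolding N_def \<psi>_def by (rule suboptimality_gap)
qed

end
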